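(* Let $A$ be a plane partition. Then $A$ is additive if and only if $nA$ is minimal and $\pi$-unique for all $n\in\mathbb{N}$.
   Context: $\mathbb{N}$ is the set of positive integers. A plane partition is a (finite, $p\times q$) matrix with nonnegative integer entries whose rows and columns are weakly decreasing. For vectors $\alpha\in\mathbb{N}_0^p$, $\beta\in\mathbb{N}_0^q$ with equal coordinate sums (where $\mathbb{N}_0=\mathbb{N}\cup\{0\}$), $\mathsf{M}(\alpha,\beta)$ is the set of $p\times q$ matrices with nonnegative integer entries, row-sum vector $\alpha$ and column-sum vector $\beta$. For a matrix $A$, $\pi(A)$ is the sequence of entries of $A$ arranged in weakly decreasing order. Such sequences (with the same sum) are compared by the dominance order: $\sigma\preccurlyeq\tau$ if $\sum_{i\le k}\sigma_i\le\sum_{i\le k}\tau_i$ for all $k$; and $\sigma\prec\tau$ means $\sigma\preccurlyeq\tau$ and $\sigma\ne\tau$. Let $A$ be a matrix with nonnegative integer entries, with row-sum vector $\alpha$ and column-sum vector $\beta$. $A$ is minimal if there is no matrix $B\in\mathsf{M}(\alpha,\beta)$ with $\pi(B)\prec\pi(A)$. $A$ is $\pi$-unique if there is no other matrix $B\in\mathsf{M}(\alpha,\beta)$ with $\pi(B)=\pi(A)$. A $p\times q$ matrix $A=(a_{i,j})$ with nonnegative integer entries is called additive if there exist real numbers $x_1,\dots,x_p,y_1,\dots,y_q$ such that $a_{i,j}>a_{k,l}$ implies $x_i+y_j>x_k+y_l$, for all $i,k\in\{1,\dots,p\}$ and all $j,l\in\{1,\dots,q\}$. *)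

theory Defs
  imports Complex_Main "Jordan_Normal_Form.Matrix"
begin

(* Rows and columns are indexed from 0, as in Jordan_Normal_Form. *)

definition plane_partition :: "nat mat \<Rightarrow> bool" where
  "plane_partition A \<longleftrightarrow>
     (\<forall>i < dim_row A. \<forall>j < dim_col A. \<forall>j' < dim_col A.
        j \<le> j' \<longrightarrow> A $$ (i, j') \<le> A $$ (i, j)) \<and>
     (\<forall>j < dim_col A. \<forall>i < dim_row A. \<forall>i' < dim_row A.
        i \<le> i' \<longrightarrow> A $$ (i', j) \<le> A $$ (i, j))"

definition row_sums :: "nat mat \<Rightarrow> nat vec" where
  "row_sums A = vec (dim_row A) (\<lambda>i. \<Sum>j<dim_col A. A $$ (i, j))"

definition col_sums :: "nat mat \<Rightarrow> nat vec" where
  "col_sums A = vec (dim_col A) (\<lambda>j. \<Sum>i<dim_row A. A $$ (i, j))"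

definition margin_class :: "nat vec \<Rightarrow> nat vec \<Rightarrow> nat mat set" where
  "margin_class \<alpha> \<beta> =
     {B \<in> carrier_mat (dim_vec \<alpha>) (dim_vec \<beta>). row_sums B = \<alpha> \<and> col_sums B = \<beta>}"

(* The entries of A, with multiplicity, in weakly decreasing order: a list of length p * q. *)
definition pi_seq :: "nat mat \<Rightarrow> nat list" where
  "pi_seq A = rev (sort [A $$ (i, j). i \<leftarrow> [0..<dim_row A], j \<leftarrow> [0..<dim_col A]])"

(* The dominance order compares only sequences of equal sum; take k is the whole list
   for k beyond its length, so shorter sequences are implicitly padded with zeros. *)
definition dominance_le :: "nat list \<Rightarrow> nat list \<Rightarrow> bool" where
  "dominance_le \<sigma> \<tau> \<longleftrightarrow>
     sum_list \<sigma> = sum_list \<tau> \<and> (\<forall>k. sum_list (take k \<sigma>) \<le> sum_list (take k \<tau>))"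

definition dominance_less :: "nat list \<Rightarrow> nat list \<Rightarrow> bool" where
  "dominance_less \<sigma> \<tau> \<longleftrightarrow> dominance_le \<sigma> \<tau> \<and> \<sigma> \<noteq> \<tau>"

definition minimal_mat :: "nat mat \<Rightarrow> bool" where
  "minimal_mat A \<longleftrightarrow>
     \<not> (\<exists>B \<in> margin_class (row_sums A) (col_sums A). dominance_less (pi_seq B) (pi_seq A))"

definition pi_unique :: "nat mat \<Rightarrow> bool" where
  "pi_unique A \<longleftrightarrow>
     \<not> (\<exists>B \<in> margin_class (row_sums A) (col_sums A). B \<noteq> A \<and> pi_seq B = pi_seq A)"

definition additive_mat :: "nat mat \<Rightarrow> bool" where
  "additive_mat A \<longleftrightarrow>
     (\<exists>(x :: nat \<Rightarrow> real) (y :: nat \<Rightarrow> real).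
        \<forall>i < dim_row A. \<forall>k < dim_row A. \<forall>j < dim_col A. \<forall>l < dim_col A.
          A $$ (i, j) > A $$ (k, l) \<longrightarrow> x i + y j > x k + y l)"

end

theory Submission
  imports Defs "HOL-Library.Function_Algebras"
begin

text \<open>
  Call a matrix \<^emph>\<open>rigid\<close> if it is the only matrix with its margins whose sorted entries are
  dominated by its own. Being minimal and \<open>\<pi>\<close>-unique is the same as being rigid, so the theorem
  says that \<open>A\<close> is additive iff every positive multiple of \<open>A\<close> is rigid.

  Everything rests on one way to read the dominance order. The \<open>k\<close>-th initial sum of the sorted
  entries of \<open>B\<close> is the largest sum of \<open>B\<close> over a set of \<open>k\<close> cells, and the maximum is attained
  by the sets that \<open>B\<close> ranks at the top (\<open>sum_le_take_pi_seq\<close>,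
  \<open>sum_leading_eq_take_pi_seq\<close>).

  \<^emph>\<open>Additive matrices are rigid\<close> (\<open>additive_mat_rigid\<close>). Let \<open>z(i,j) = x\<^sub>i + y\<^sub>j\<close> witness that \<open>A\<close>
  is additive, let \<open>B\<close> have the same margins as \<open>A\<close> and be dominated by \<open>A\<close>, and put \<open>D = A - B\<close>.
  Equal margins say that \<open>D\<close> is orthogonal to \<open>z\<close>. On the other hand, \<open>A\<close> has at least the sum of \<open>B\<close>
  on every set that \<open>A\<close> ranks at the top, so by summation by parts \<open>D\<close> has a nonnegative inner
  product with \<^emph>\<open>every\<close> real function \<open>h\<close> on the cells that increases strictly where \<open>A\<close> does. This
  is an open condition on \<open>h\<close>, so \<open>h = N z - D\<close> satisfies it for large \<open>N\<close>. For this \<open>h\<close> the inner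
  product is minus the sum of the squares of \<open>D\<close>; hence \<open>D = 0\<close>.

  \<^emph>\<open>A non-additive matrix has a multiple that is not rigid\<close> (\<open>not_additive_imp_ex_dominated\<close>).
  Additivity is a finite system of strict homogeneous linear inequalities with integer coefficients.
  If it has no solution, Gordan's theorem gives a nonempty sum \<open>D\<close> of unit transfers \<open>e\<^sub>c - e\<^sub>d\<close> with
  \<open>A\<^sub>c > A\<^sub>d\<close> such that all row and column sums of \<open>D\<close> vanish. Then \<open>B = n A - D\<close> has the margins of
  \<open>n A\<close>. It is nonnegative for large \<open>n\<close>, because \<open>D\<close> is never positive where \<open>A\<close> is zero, and for
  large \<open>n\<close> it also preserves all strict inequalities between entries of \<open>A\<close>. A set that \<open>B\<close> ranks
  at the top is therefore ranked at the top by \<open>A\<close>. Whenever it contains the smaller cell \<open>d\<close> of a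
  transfer \<open>e\<^sub>c - e\<^sub>d\<close>, it contains the larger cell \<open>c\<close> too, so \<open>D\<close> has a nonnegative sum over it.
  Passing from \<open>n A\<close> to \<open>B\<close> thus does not increase any initial sum.
\<close>

section \<open>A theorem of the alternative over the integers\<close>

text \<open>The elements are the finite sums with positive integer weights, not all zero. Generating them
  by addition makes the integrality and the nontriviality of the weights automatic, and reduces
  properties of all such sums to properties of the generators.\<close>

inductive_set semigroup_hull :: "'a::ab_semigroup_add set \<Rightarrow> 'a set" for V where
  base: "v \<in> V \<Longrightarrow> v \<in> semigroup_hull V"
| add: "u \<in> semigroup_hull V \<Longrightarrow> v \<in> semigroup_hull V \<Longrightarrow> u + v \<in> semigroup_hull V"

lemma semigroup_hull_subset:
  assumes "w \<in> semigroup_hull W" "W \<subseteq> semigroup_hull V"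
  shows "w \<in> semigroup_hull V"
  using assms by induction (auto intro: semigroup_hull.add)

lemma semigroup_hull_multiple:
  fixes f :: "'i \<Rightarrow> 'a::ab_semigroup_add \<Rightarrow> int"
  assumes additive: "\<And>i u v. i \<in> I \<Longrightarrow> f i (u + v) = f i u + f i v"
    and v: "v \<in> semigroup_hull V" and k: "0 < k"
  shows "\<exists>w\<in>semigroup_hull V. \<forall>i\<in>I. f i w = k * f i v"
proof -
  have "1 \<le> k" using k by simp
  then show ?thesis
  proof (induction k rule: int_ge_induct)
    case base
    then show ?case using v by auto
  next
    case (step k)
    then obtain w where "w \<in> semigroup_hull V" "\<forall>i\<in>I. f i w = k * f i v" by blast
    then show ?case
      using v additive by (intro bexI[of _ "w + v"]) (auto simp: algebra_simps intro: semigroup_hull.add)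
  qed
qed

lemma ex_between_finite:
  fixes S T :: "real set"
  assumes "finite S" "finite T" "\<And>s t. s \<in> S \<Longrightarrow> t \<in> T \<Longrightarrow> s < t"
  shows "\<exists>r. (\<forall>s\<in>S. s < r) \<and> (\<forall>t\<in>T. r < t)"
proof (cases "S = {} \<or> T = {}")
  case True
  then show ?thesis
    using finite_imp_Sup_less[of S] finite_imp_less_Inf[of T]
      gt_ex[of "Max S"] lt_ex[of "Min T"] assms(1,2)
    by (metis Max_less_iff Min_gr_iff empty_iff)
next
  case False
  then have "Max S < Min T"
    using assms by simp
  then obtain r where "Max S < r" "r < Min T"
    using dense by blast
  then show ?thesis
    using False assms by auto
qed

text \<open>Gordan's theorem with integer weights, by Fourier--Motzkin elimination of one inequality
  variable at a time. To eliminate the variable of \<open>a\<close>, replace each pair of a vector \<open>v\<close> with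
  \<open>f a v > 0\<close> and a vector \<open>u\<close> with \<open>f a u < 0\<close> by its positive combination on which \<open>f a\<close>
  vanishes. A positive integer combination of the new vectors is one of the old vectors. A solution
  for the new vectors extends to the old ones, because the new inequalities say precisely that each
  lower bound on the value at \<open>a\<close> is below each upper bound.\<close>

lemma gordan_alternative:
  fixes f :: "'i \<Rightarrow> 'a::ab_semigroup_add \<Rightarrow> int"
  assumes "finite I" "finite V"
    and "\<And>i u v. i \<in> I \<Longrightarrow> f i (u + v) = f i u + f i v"
  shows "(\<exists>x :: 'i \<Rightarrow> real. \<forall>v\<in>V. 0 < (\<Sum>i\<in>I. x i * f i v))
    \<or> (\<exists>w\<in>semigroup_hull V. \<forall>i\<in>I. f i w = 0)"
  using assms
proof (induction I arbitrary: V rule: finite_induct)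
  case empty
  then show ?case
    by (cases "V = {}") (auto intro: semigroup_hull.base)
next
  case (insert a I)
  define P N where "P = {v \<in> V. 0 < f a v}" and "N = {v \<in> V. f a v < 0}"
  have finPN: "finite P" "finite N"
    using insert.prems(1) by (auto simp: P_def N_def)
  have "\<exists>w\<in>semigroup_hull V. \<forall>i\<in>insert a I. f i w = (- f a u) * f i v + f a v * f i u"
    if "v \<in> P" "u \<in> N" for v u
  proof -
    have hull: "v \<in> semigroup_hull V" "u \<in> semigroup_hull V" and pos: "0 < - f a u" "0 < f a v"
      using that by (auto simp: P_def N_def intro: semigroup_hull.base)
    obtain v' where v': "v' \<in> semigroup_hull V" "\<forall>i\<in>insert a I. f i v' = (- f a u) * f i v"
      using semigroup_hull_multiple[of "insert a I" f v V "- f a u", OF insert.prems(2)] hull pos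
      by blast
    obtain u' where u': "u' \<in> semigroup_hull V" "\<forall>i\<in>insert a I. f i u' = f a v * f i u"
      using semigroup_hull_multiple[of "insert a I" f u V "f a v", OF insert.prems(2)] hull pos
      by blast
    show ?thesis
      using v' u' insert.prems(2) by (intro bexI[of _ "v' + u'"]) (auto intro: semigroup_hull.add)
  qed
  then obtain g where g: "\<And>v u. v \<in> P \<Longrightarrow> u \<in> N \<Longrightarrow> g v u \<in> semigroup_hull V"
      "\<And>v u i. v \<in> P \<Longrightarrow> u \<in> N \<Longrightarrow> i \<in> insert a I
         \<Longrightarrow> f i (g v u) = (- f a u) * f i v + f a v * f i u"
    by metis
  define W where "W = {v \<in> V. f a v = 0} \<union> (\<lambda>(v, u). g v u) ` (P \<times> N)"
  have finW: "finite W"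
    using insert.prems(1) finPN by (simp add: W_def)
  have Wsub: "W \<subseteq> semigroup_hull V"
    using g(1) by (auto simp: W_def intro: semigroup_hull.base)
  have Wa: "f a w = 0" if "w \<in> W" for w
    using that g(2)[where i = a] by (auto simp: W_def)
  consider x where "\<forall>v\<in>W. 0 < (\<Sum>i\<in>I. (x i :: real) * f i v)"
    | w where "w \<in> semigroup_hull W" "\<forall>i\<in>I. f i w = 0"
    using insert.IH[OF finW] insert.prems(2) by blast
  then show ?case
  proof cases
    case 2
    have "f a w = 0"
      using 2(1) by induction (simp_all add: Wa insert.prems(2))
    then show ?thesis
      using 2 semigroup_hull_subset[OF 2(1) Wsub] by auto
  next
    case 1
    define L where "L v = (\<Sum>i\<in>I. x i * f i v)" for v
    have less: "- L v / f a v < L u / (- f a u)" if "v \<in> P" "u \<in> N" for v u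
    proof -
      have "0 < L (g v u)"
        using 1 that by (auto simp: L_def W_def)
      also have "L (g v u) = (- f a u) * L v + f a v * L u"
      proof -
        have "L (g v u) = (\<Sum>i\<in>I. (- f a u) * (x i * f i v) + f a v * (x i * f i u))"
          unfolding L_def
        proof (rule sum.cong)
          show "x i * f i (g v u) = (- f a u) * (x i * f i v) + f a v * (x i * f i u)"
            if "i \<in> I" for i
          proof -
            have eq: "f i (g v u) = (- f a u) * f i v + f a v * f i u"
              using g(2) \<open>v \<in> P\<close> \<open>u \<in> N\<close> that by blast
            show ?thesis
              unfolding eq by (simp add: algebra_simps)
          qed
        qed simp
        then show ?thesis
          by (simp only: L_def sum.distrib sum_distrib_left)
      qed
      finally show ?thesis
        using that by (simp add: P_def N_def field_simps)
    qed
    have "\<exists>t. (\<forall>s\<in>(\<lambda>v. - L v / f a v) ` P. s < t) \<and> (\<forall>s\<in>(\<lambda>u. L u / (- f a u)) ` N. t < s)"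
    proof (rule ex_between_finite)
      show "s < s'" if "s \<in> (\<lambda>v. - L v / f a v) ` P" "s' \<in> (\<lambda>u. L u / (- f a u)) ` N" for s s'
        using that by (elim imageE) (simp only: less)
    qed (use finPN in simp_all)
    then obtain t where t: "\<forall>v\<in>P. - L v / f a v < t" "\<forall>u\<in>N. t < L u / (- f a u)"
      by (elim exE conjE) (simp only: ball_simps)
    have "0 < L v + t * f a v" if v: "v \<in> V" for v
    proof -
      consider (pos) "v \<in> P" | (neg) "v \<in> N" | (zero) "f a v = 0"
        using v linorder_less_linear[of "f a v" 0] by (auto simp: P_def N_def)
      then show ?thesis
      proof cases
        case pos
        then have "- L v / f a v < t" "0 < real_of_int (f a v)"
          using t(1) by (auto simp: P_def)
        then have "- L v < t * f a v"
          using pos_divide_less_eq[of "real_of_int (f a v)" "- L v" t] by blast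
        then show ?thesis by simp
      next
        case neg
        then have "t < L v / (- f a v)" "0 < - real_of_int (f a v)"
          using t(2) by (auto simp: N_def)
        then have "t * (- real_of_int (f a v)) < L v"
          using pos_less_divide_eq[of "- real_of_int (f a v)" t "L v"] by simp
        then show ?thesis by simp
      next
        case zero
        then show ?thesis using 1 v by (simp add: W_def L_def)
      qed
    qed
    moreover have "(\<Sum>i\<in>insert a I. (x(a := t)) i * f i v) = L v + t * f a v" for v
    proof -
      have "(\<Sum>i\<in>I. (x(a := t)) i * f i v) = L v"
        unfolding L_def using insert.hyps(2) by (intro sum.cong) auto
      then show ?thesis using insert.hyps by simp
    qed
    ultimately have "\<forall>v\<in>V. 0 < (\<Sum>i\<in>insert a I. (x(a := t)) i * f i v)"
      by (simp only:) simp
    then show ?thesis by blast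
  qed
qed

section \<open>Leading sets and initial sums of the sorted entries\<close>

text \<open>The inequality is weak, so cells with equal values may be divided between \<open>U\<close> and its
  complement in any way. This is what lets a set that is leading for a function be leading also for
  a coarser one.\<close>

definition leading :: "'c set \<Rightarrow> ('c \<Rightarrow> 'a::linorder) \<Rightarrow> 'c set \<Rightarrow> bool" where
  "leading Z h U \<longleftrightarrow> U \<subseteq> Z \<and> (\<forall>c\<in>U. \<forall>d\<in>Z - U. h d \<le> h c)"

text \<open>Exchange argument: match the cells of \<open>V\<close> outside \<open>U\<close> with those of \<open>U\<close> outside \<open>V\<close>; every
  exchange replaces a value by one that is at least as large.\<close>

lemma sum_le_sum_leading:
  fixes b :: "'c \<Rightarrow> nat"
  assumes fin: "finite Z" and lead: "leading Z b U"
    and sub: "V \<subseteq> Z" and card: "card V = card U"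
  shows "sum b V \<le> sum b U"
proof -
  have UZ: "U \<subseteq> Z" using lead by (simp add: leading_def)
  have finU: "finite U" and finV: "finite V"
    using fin UZ sub finite_subset by blast+
  have "card (V - U) = card (U - V)"
    using card card_Diff_subset_Int[of V U] card_Diff_subset_Int[of U V] finU finV
    by (simp add: Int_commute)
  then obtain g where g: "bij_betw g (V - U) (U - V)"
    using finite_same_card_bij[of "V - U" "U - V"] finU finV by auto
  have "sum b (V - U) \<le> (\<Sum>c\<in>V - U. b (g c))"
  proof (rule sum_mono)
    fix c assume c: "c \<in> V - U"
    then have "g c \<in> U" using g by (auto simp: bij_betw_def)
    then show "b c \<le> b (g c)" using c lead sub by (auto simp: leading_def)
  qed
  also have "\<dots> = sum b (U - V)"
    by (rule sum.reindex_bij_betw[OF g])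
  finally have "sum b (V - U) + sum b (V \<inter> U) \<le> sum b (U - V) + sum b (V \<inter> U)"
    by simp
  then show ?thesis
    using sum.Int_Diff[OF finV, of b U] sum.Int_Diff[OF finU, of b V]
    by (simp add: Int_commute add.commute)
qed

lemma ex_leading_sum_take:
  fixes b :: "'c \<Rightarrow> nat"
  assumes dist: "distinct cs" and k: "k \<le> length cs"
  shows "\<exists>U. leading (set cs) b U \<and> card U = k
    \<and> sum b U = sum_list (take k (rev (sort (map b cs))))"
proof -
  define ds where "ds = rev (sort_key b cs)"
  have ds: "distinct ds" "set ds = set cs" "length ds = length cs"
    using dist by (auto simp: ds_def)
  have "sort (map b cs) = map b (sort_key b cs)"
    by (rule properties_for_sort) simp_all
  then have map_ds: "rev (sort (map b cs)) = map b ds"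
    by (simp add: ds_def rev_map)
  have sorted: "sorted_wrt (\<lambda>c d. b d \<le> b c) ds"
    using sorted_sort_key[of b cs] by (simp add: ds_def sorted_wrt_rev sorted_wrt_map)
  let ?U = "set (take k ds)"
  have split: "set cs = ?U \<union> set (drop k ds)"
    using ds(2) by (metis append_take_drop_id set_append)
  have "sorted_wrt (\<lambda>c d. b d \<le> b c) (take k ds @ drop k ds)"
    using sorted by simp
  then have "leading (set cs) b ?U"
    unfolding sorted_wrt_append leading_def using split by auto
  moreover have "card ?U = k"
    using ds k by (simp add: distinct_card)
  moreover have "sum b ?U = sum_list (take k (map b ds))"
    using ds(1) by (simp add: sum_list_distinct_conv_sum_set take_map)
  ultimately show ?thesis
    using map_ds by metis
qed

definition cells :: "nat mat \<Rightarrow> (nat \<times> nat) set" where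
  "cells A = {..<dim_row A} \<times> {..<dim_col A}"

lemma finite_cells [simp]: "finite (cells A)"
  by (simp add: cells_def)

lemma pi_seq_eq_sort_product:
  "pi_seq A = rev (sort (map (($$) A) (List.product [0..<dim_row A] [0..<dim_col A])))"
  by (simp add: pi_seq_def product_concat_map map_concat comp_def)

lemma set_product_cells: "set (List.product [0..<dim_row A] [0..<dim_col A]) = cells A"
  by (auto simp: cells_def)

lemma length_pi_seq: "length (pi_seq A) = card (cells A)"
  by (simp add: pi_seq_eq_sort_product cells_def)

lemma ex_leading_pi_seq:
  assumes "k \<le> card (cells A)"
  shows "\<exists>U. leading (cells A) (($$) A) U \<and> card U = k \<and> sum (($$) A) U = sum_list (take k (pi_seq A))"
  using ex_leading_sum_take[of "List.product [0..<dim_row A] [0..<dim_col A]" k "($$) A"] assms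
  unfolding set_product_cells pi_seq_eq_sort_product[symmetric]
  by (simp add: distinct_product cells_def)

lemma sum_le_take_pi_seq:
  assumes "V \<subseteq> cells A"
  shows "sum (($$) A) V \<le> sum_list (take (card V) (pi_seq A))"
proof -
  have "card V \<le> card (cells A)"
    using assms by (simp add: card_mono)
  then obtain U where "leading (cells A) (($$) A) U" "card U = card V"
      "sum (($$) A) U = sum_list (take (card V) (pi_seq A))"
    using ex_leading_pi_seq by blast
  then show ?thesis
    using sum_le_sum_leading[of "cells A" "($$) A" U V] assms by simp
qed

lemma sum_leading_eq_take_pi_seq:
  assumes "leading (cells A) (($$) A) U"
  shows "sum (($$) A) U = sum_list (take (card U) (pi_seq A))"
proof (rule antisym)
  have sub: "U \<subseteq> cells A" using assms by (simp add: leading_def)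
  then show "sum (($$) A) U \<le> sum_list (take (card U) (pi_seq A))"
    by (rule sum_le_take_pi_seq)
  have "card U \<le> card (cells A)"
    using sub by (simp add: card_mono)
  then obtain V where "leading (cells A) (($$) A) V" "card V = card U"
      "sum (($$) A) V = sum_list (take (card U) (pi_seq A))"
    using ex_leading_pi_seq by blast
  then show "sum_list (take (card U) (pi_seq A)) \<le> sum (($$) A) U"
    using sum_le_sum_leading[of "cells A" "($$) A" U V] assms by (simp add: leading_def)
qed

lemma sum_list_pi_seq: "sum_list (pi_seq A) = sum (($$) A) (cells A)"
  using sum_leading_eq_take_pi_seq[of A "cells A"] length_pi_seq[of A]
  by (simp add: leading_def)

section \<open>Margins\<close>

lemma margin_classD:
  assumes "B \<in> margin_class (row_sums A) (col_sums A)"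
  shows "dim_row B = dim_row A" "dim_col B = dim_col A" "cells B = cells A"
    "\<And>i. i < dim_row A \<Longrightarrow> (\<Sum>j<dim_col A. B $$ (i, j)) = (\<Sum>j<dim_col A. A $$ (i, j))"
    "\<And>j. j < dim_col A \<Longrightarrow> (\<Sum>i<dim_row A. B $$ (i, j)) = (\<Sum>i<dim_row A. A $$ (i, j))"
proof -
  show dims: "dim_row B = dim_row A" "dim_col B = dim_col A"
    using assms by (auto simp: margin_class_def row_sums_def col_sums_def)
  then show "cells B = cells A" by (simp add: cells_def)
  have rows: "row_sums B = row_sums A" and cols: "col_sums B = col_sums A"
    using assms by (auto simp: margin_class_def)
  show "(\<Sum>j<dim_col A. B $$ (i, j)) = (\<Sum>j<dim_col A. A $$ (i, j))" if "i < dim_row A" for i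
    using arg_cong[OF rows, of "\<lambda>v. v $ i"] that dims by (simp add: row_sums_def)
  show "(\<Sum>i<dim_row A. B $$ (i, j)) = (\<Sum>i<dim_row A. A $$ (i, j))" if "j < dim_col A" for j
    using arg_cong[OF cols, of "\<lambda>v. v $ j"] that dims by (simp add: col_sums_def)
qed

lemma margin_classI:
  assumes "dim_row B = dim_row A" "dim_col B = dim_col A"
    "\<And>i. i < dim_row A \<Longrightarrow> (\<Sum>j<dim_col A. B $$ (i, j)) = (\<Sum>j<dim_col A. A $$ (i, j))"
    "\<And>j. j < dim_col A \<Longrightarrow> (\<Sum>i<dim_row A. B $$ (i, j)) = (\<Sum>i<dim_row A. A $$ (i, j))"
  shows "B \<in> margin_class (row_sums A) (col_sums A)"
proof -
  have "row_sums B = row_sums A"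
    by (rule eq_vecI) (simp_all add: row_sums_def assms)
  moreover have "col_sums B = col_sums A"
    by (rule eq_vecI) (simp_all add: col_sums_def assms)
  moreover have "B \<in> carrier_mat (dim_vec (row_sums A)) (dim_vec (col_sums A))"
    by (intro carrier_matI) (simp_all add: row_sums_def col_sums_def assms(1,2))
  ultimately show ?thesis
    by (simp add: margin_class_def)
qed

text \<open>Pairing \<open>D\<close> with a potential of the form \<open>x\<^sub>i + y\<^sub>j\<close> depends on the margins of \<open>D\<close> only: the
  row and column sums are the adjoint of the map that sends \<open>(x, y)\<close> to the potential. This
  identity is used in both directions of the theorem.\<close>

lemma sum_pairing_margins:
  fixes D :: "nat \<times> nat \<Rightarrow> real"
  shows "(\<Sum>(i, j)\<in>{..<p} \<times> {..<q}. (x i + y j) * D (i, j))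
    = (\<Sum>i<p. x i * (\<Sum>j<q. D (i, j))) + (\<Sum>j<q. y j * (\<Sum>i<p. D (i, j)))"
proof -
  have "(\<Sum>(i, j)\<in>{..<p} \<times> {..<q}. (x i + y j) * D (i, j))
      = (\<Sum>i<p. \<Sum>j<q. x i * D (i, j)) + (\<Sum>i<p. \<Sum>j<q. y j * D (i, j))"
    by (simp add: sum.cartesian_product[symmetric] distrib_right sum.distrib)
  also have "(\<Sum>i<p. \<Sum>j<q. y j * D (i, j)) = (\<Sum>j<q. \<Sum>i<p. y j * D (i, j))"
    by (rule sum.swap)
  finally show ?thesis
    by (simp add: sum_distrib_left)
qed

section \<open>Additive matrices\<close>

text \<open>Summation by parts without an enumeration of the cells. The cells are added in the order of
  decreasing \<open>h\<close>; adding \<open>a\<close> lowers the reference level from \<open>h a\<close> to \<open>m\<close>, which contributes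
  \<open>h a - m\<close> times a leading sum. The level \<open>m\<close> is arbitrary so that the induction hypothesis can
  be used at level \<open>h a\<close>.\<close>

lemma sum_mult_nonneg_if_leading_sums_nonneg:
  fixes h w :: "'c \<Rightarrow> real"
  assumes "finite Z" "\<And>U. leading Z h U \<Longrightarrow> 0 \<le> sum w U" "\<And>c. c \<in> Z \<Longrightarrow> m \<le> h c"
  shows "0 \<le> (\<Sum>c\<in>Z. (h c - m) * w c)"
  using assms
proof (induction Z arbitrary: m rule: finite_ranking_induct[where f = "\<lambda>c. - h c"])
  case empty
  then show ?case by simp
next
  case (insert a S)
  show ?case
  proof (cases "a \<in> S")
    case True
    then show ?thesis using insert by (simp add: insert_absorb)
  next
    case False
    have lowest: "h a \<le> h c" if "c \<in> S" for c
      using insert.hyps(2)[OF that] by simp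
    have "leading (insert a S) h U" if "leading S h U" for U
      using that lowest unfolding leading_def by blast
    then have "0 \<le> (\<Sum>c\<in>S. (h c - h a) * w c)"
      using insert.IH[of "h a"] insert.prems(1) lowest by blast
    moreover have "0 \<le> (h a - m) * sum w (insert a S)"
      using insert.prems by (intro mult_nonneg_nonneg) (auto simp: leading_def)
    moreover have "(\<Sum>c\<in>insert a S. (h c - m) * w c)
        = (\<Sum>c\<in>S. (h c - h a) * w c) + (h a - m) * sum w (insert a S)"
    proof -
      have "(\<Sum>c\<in>S. (h c - m) * w c) = (\<Sum>c\<in>S. (h c - h a) * w c + (h a - m) * w c)"
        by (intro sum.cong) (auto simp: algebra_simps)
      also have "\<dots> = (\<Sum>c\<in>S. (h c - h a) * w c) + (h a - m) * sum w S"
        by (simp add: sum.distrib sum_distrib_left)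
      finally show ?thesis
        using insert.hyps(1) False by (simp add: distrib_left)
    qed
    ultimately show ?thesis by linarith
  qed
qed

text \<open>Since \<open>h\<close> increases strictly where \<open>A\<close> does, a leading set of \<open>h\<close> is one of \<open>A\<close>. On such a
  set the sum of \<open>A\<close> is an initial sum of its sorted entries, while the sum of \<open>B\<close> is at most the
  corresponding initial sum for \<open>B\<close>.\<close>

lemma sum_potential_diff_nonneg:
  fixes h :: "nat \<times> nat \<Rightarrow> real"
  assumes strict: "\<And>c d. c \<in> cells A \<Longrightarrow> d \<in> cells A \<Longrightarrow> A $$ d < A $$ c \<Longrightarrow> h d < h c"
    and cells: "cells B = cells A" and dom: "dominance_le (pi_seq B) (pi_seq A)"
  shows "0 \<le> (\<Sum>c\<in>cells A. h c * (real (A $$ c) - real (B $$ c)))"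
proof -
  let ?w = "\<lambda>c. real (A $$ c) - real (B $$ c)"
  define m where "m = Min (h ` cells A)"
  have "0 \<le> sum ?w U" if U: "leading (cells A) h U" for U
  proof -
    have "leading (cells A) (($$) A) U"
      using U strict unfolding leading_def by (meson DiffD1 not_le subsetD)
    then have "sum (($$) A) U = sum_list (take (card U) (pi_seq A))"
      by (rule sum_leading_eq_take_pi_seq)
    moreover have "sum (($$) B) U \<le> sum_list (take (card U) (pi_seq B))"
      using U cells by (intro sum_le_take_pi_seq) (simp add: leading_def)
    ultimately have "sum (($$) B) U \<le> sum (($$) A) U"
      using dom unfolding dominance_le_def by (metis order_trans)
    then show ?thesis
      by (simp add: sum_subtractf flip: of_nat_sum)
  qed
  moreover have "m \<le> h c" if "c \<in> cells A" for c
    using that by (simp add: m_def)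
  ultimately have "0 \<le> (\<Sum>c\<in>cells A. (h c - m) * ?w c)"
    by (intro sum_mult_nonneg_if_leading_sums_nonneg) auto
  also have "\<dots> = (\<Sum>c\<in>cells A. h c * ?w c) - m * sum ?w (cells A)"
    unfolding left_diff_distrib sum_subtractf[of "\<lambda>c. h c * ?w c"] sum_distrib_left ..
  also have "sum ?w (cells A) = 0"
    using dom sum_list_pi_seq[of A] sum_list_pi_seq[of B] cells
    by (simp add: dominance_le_def sum_subtractf flip: of_nat_sum)
  finally show ?thesis by simp
qed

text \<open>With \<open>h\<close> equal to the witness \<open>z\<close> of additivity, \<open>sum_potential_diff_nonneg\<close> would yield only
  \<open>0 \<le> 0\<close>. It is applied instead to \<open>N z - D\<close>, which has, up to scale, the direction of \<open>z\<close> tilted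
  slightly against \<open>D\<close>.\<close>

lemma additive_mat_rigid:
  assumes add: "additive_mat A" and B: "B \<in> margin_class (row_sums A) (col_sums A)"
    and dom: "dominance_le (pi_seq B) (pi_seq A)"
  shows "B = A"
proof -
  note B_facts = margin_classD[OF B]
  obtain x y :: "nat \<Rightarrow> real" where xy:
    "\<forall>i < dim_row A. \<forall>k < dim_row A. \<forall>j < dim_col A. \<forall>l < dim_col A.
       A $$ (i, j) > A $$ (k, l) \<longrightarrow> x i + y j > x k + y l"
    using add unfolding additive_mat_def by blast
  define z where "z = (\<lambda>(i, j). x i + y j)"
  have z: "z d < z c" if "c \<in> cells A" "d \<in> cells A" "A $$ d < A $$ c" for c d
    using that xy by (cases c; cases d) (auto simp: z_def cells_def)
  define D where "D c = real (A $$ c) - real (B $$ c)" for c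
  \<comment> \<open>For large \<open>N\<close>, the finitely many positive gaps of \<open>N z\<close> exceed all differences of \<open>D\<close>.\<close>
  have "\<forall>\<^sub>F N in at_top. \<forall>e\<in>{(c, d) \<in> cells A \<times> cells A. A $$ d < A $$ c}.
      N * z (snd e) - D (snd e) < N * z (fst e) - D (fst e)"
  proof (intro eventually_ball_finite ballI)
    show "finite {(c, d) \<in> cells A \<times> cells A. A $$ d < A $$ c}"
      by (rule finite_subset[of _ "cells A \<times> cells A"]) auto
    fix e assume "e \<in> {(c, d) \<in> cells A \<times> cells A. A $$ d < A $$ c}"
    then have gap: "0 < z (fst e) - z (snd e)"
      using z by (cases e) auto
    show "\<forall>\<^sub>F N in at_top. N * z (snd e) - D (snd e) < N * z (fst e) - D (fst e)"
      using eventually_gt_at_top[of "(D (fst e) - D (snd e)) / (z (fst e) - z (snd e))"]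
    proof eventually_elim
      case (elim N)
      then show ?case using gap by (simp add: pos_divide_less_eq algebra_simps)
    qed
  qed
  then obtain N where N: "\<And>c d. c \<in> cells A \<Longrightarrow> d \<in> cells A \<Longrightarrow> A $$ d < A $$ c
      \<Longrightarrow> N * z d - D d < N * z c - D c"
    by (fastforce simp: eventually_at_top_linorder)
  have zD: "(\<Sum>c\<in>cells A. z c * D c) = 0"
  proof -
    have "(\<Sum>c\<in>cells A. z c * D c)
        = (\<Sum>(i, j)\<in>{..<dim_row A} \<times> {..<dim_col A}. (x i + y j) * D (i, j))"
      by (intro sum.cong) (auto simp: cells_def z_def)
    then show ?thesis
      unfolding sum_pairing_margins
      using B_facts(4,5) by (simp add: D_def sum_subtractf flip: of_nat_sum)
  qed
  have "0 \<le> (\<Sum>c\<in>cells A. (N * z c - D c) * D c)"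
    using sum_potential_diff_nonneg[OF N B_facts(3) dom] by (simp add: D_def)
  also have "\<dots> = N * (\<Sum>c\<in>cells A. z c * D c) - (\<Sum>c\<in>cells A. D c * D c)"
    by (simp add: left_diff_distrib sum_subtractf sum_distrib_left mult.assoc)
  finally have "(\<Sum>c\<in>cells A. D c * D c) \<le> 0"
    using zD by simp
  then have "(\<Sum>c\<in>cells A. D c * D c) = 0"
    by (intro antisym sum_nonneg) auto
  then have "\<forall>c\<in>cells A. D c = 0"
    by (subst (asm) sum_nonneg_eq_0_iff) auto
  then show "B = A"
    using B_facts(1,2) by (intro eq_matI) (auto simp: D_def cells_def)
qed

lemma additive_mat_smult:
  assumes "additive_mat A"
  shows "additive_mat (n \<cdot>\<^sub>m A)"
  using assms unfolding additive_mat_def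
  by (simp) blast

section \<open>Matrices that are not additive\<close>

definition transfer :: "'c \<Rightarrow> 'c \<Rightarrow> 'c \<Rightarrow> int" where
  "transfer c d e = of_bool (e = c) - of_bool (e = d)"

lemma sum_transfer:
  assumes "finite U"
  shows "sum (transfer c d) U = of_bool (c \<in> U) - of_bool (d \<in> U)"
  using assms by (simp add: transfer_def sum_subtractf of_bool_def)

definition descents :: "nat mat \<Rightarrow> (nat \<times> nat \<Rightarrow> int) set" where
  "descents A = {transfer c d | c d. c \<in> cells A \<and> d \<in> cells A \<and> A $$ d < A $$ c}"

text \<open>Gordan's theorem with the row sums and the column sums as the functionals. Their multipliers
  are the \<open>x\<^sub>i\<close> and \<open>y\<^sub>j\<close>: the weighted sum of the margins of a transfer from \<open>d\<close> to \<open>c\<close> is the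
  difference of the potentials at \<open>c\<close> and \<open>d\<close>.\<close>

lemma not_additive_imp_ex_margin_free:
  assumes "\<not> additive_mat A"
  obtains D where "D \<in> semigroup_hull (descents A)"
    "\<And>i. i < dim_row A \<Longrightarrow> (\<Sum>j<dim_col A. D (i, j)) = 0"
    "\<And>j. j < dim_col A \<Longrightarrow> (\<Sum>i<dim_row A. D (i, j)) = 0"
proof -
  let ?p = "dim_row A" and ?q = "dim_col A"
  define f :: "nat + nat \<Rightarrow> (nat \<times> nat \<Rightarrow> int) \<Rightarrow> int" where
    "f k D = (case k of Inl i \<Rightarrow> \<Sum>j<?q. D (i, j) | Inr j \<Rightarrow> \<Sum>i<?p. D (i, j))" for k D
  have fin: "finite (descents A)"
    by (rule finite_subset[of _ "(\<lambda>(c, d). transfer c d) ` (cells A \<times> cells A)"])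
      (auto simp: descents_def)
  have additive: "f k (D + E) = f k D + f k E" for k D E
    by (simp add: f_def sum.distrib split: sum.split)
  have no_potential: "\<not> (\<forall>v\<in>descents A. 0 < (\<Sum>k\<in>{..<?p} <+> {..<?q}. X k * f k v))"
    for X :: "nat + nat \<Rightarrow> real"
  proof
    assume X: "\<forall>v\<in>descents A. 0 < (\<Sum>k\<in>{..<?p} <+> {..<?q}. X k * f k v)"
    define z where "z = (\<lambda>(i, j). X (Inl i) + X (Inr j))"
    have "z d < z c" if cd: "c \<in> cells A" "d \<in> cells A" "A $$ d < A $$ c" for c d
    proof -
      have "0 < (\<Sum>k\<in>{..<?p} <+> {..<?q}. X k * f k (transfer c d))"
        using X cd unfolding descents_def by blast
      also have "\<dots> = (\<Sum>(i, j)\<in>{..<?p} \<times> {..<?q}.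
          (X (Inl i) + X (Inr j)) * real_of_int (transfer c d (i, j)))"
        unfolding sum_pairing_margins[where D = "\<lambda>e. real_of_int (transfer c d e)"]
        by (simp add: sum.Plus f_def)
      also have "\<dots> = (\<Sum>e\<in>cells A. (if e = c then z e else 0) - (if e = d then z e else 0))"
        by (intro sum.cong) (auto simp: cells_def z_def transfer_def of_bool_def)
      also have "\<dots> = z c - z d"
        using cd by (simp add: sum_subtractf)
      finally show ?thesis by simp
    qed
    then have "additive_mat A"
      unfolding additive_mat_def
      by (intro exI[of _ "\<lambda>i. X (Inl i)"] exI[of _ "\<lambda>j. X (Inr j)"])
        (auto simp: z_def cells_def)
    with assms show False by blast
  qed
  have "\<exists>D\<in>semigroup_hull (descents A). \<forall>k\<in>{..<?p} <+> {..<?q}. f k D = 0"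
  proof -
    have "finite ({..<?p} <+> {..<?q})" by simp
    then show ?thesis
      using gordan_alternative[of "{..<?p} <+> {..<?q}" "descents A" f, OF _ fin additive] no_potential
      by blast
  qed
  then obtain D where D: "D \<in> semigroup_hull (descents A)" "\<forall>k\<in>{..<?p} <+> {..<?q}. f k D = 0"
    by blast
  show thesis
  proof (rule that[OF D(1)])
    show "(\<Sum>j<?q. D (i, j)) = 0" if "i < ?p" for i
      using D(2) that by (auto simp: f_def dest: bspec[of _ _ "Inl i"])
    show "(\<Sum>i<?p. D (i, j)) = 0" if "j < ?q" for j
      using D(2) that by (auto simp: f_def dest: bspec[of _ _ "Inr j"])
  qed
qed

text \<open>A leading set of \<open>A\<close> that contains the smaller cell of a descent contains the larger one too.\<close>

lemma sum_leading_descents_nonneg: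
  assumes "D \<in> semigroup_hull (descents A)" and U: "leading (cells A) (($$) A) U"
  shows "0 \<le> sum D U"
  using assms(1)
proof induction
  case (base D)
  then obtain c d where cd: "D = transfer c d" "c \<in> cells A" "d \<in> cells A" "A $$ d < A $$ c"
    by (auto simp: descents_def)
  have "finite U"
    using U finite_subset[OF _ finite_cells] by (auto simp: leading_def)
  moreover have "c \<in> U" if "d \<in> U"
  proof (rule ccontr)
    assume "c \<notin> U"
    then have "A $$ c \<le> A $$ d" using U that cd(2) by (auto simp: leading_def)
    then show False using cd(4) by simp
  qed
  ultimately show ?case
    unfolding cd(1) by (simp add: sum_transfer)
next
  case (add u v)
  then show ?case by (simp add: sum.distrib)
qed

text \<open>A zero entry is never the larger cell of a descent. This keeps \<open>n A - D\<close> nonnegative where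
  increasing \<open>n\<close> does not help.\<close>

lemma descents_nonpos_at_zero:
  assumes "D \<in> semigroup_hull (descents A)" and "A $$ c = 0"
  shows "D c \<le> 0"
  using assms(1)
proof induction
  case (base D)
  then show ?case using assms(2) by (auto simp: descents_def transfer_def of_bool_def)
next
  case (add u v)
  then show ?case by simp
qed

text \<open>Guarantees that \<open>D\<close> is not zero: the transfers cannot cancel, because each of them has
  positive inner product with \<open>A\<close>.\<close>

lemma descents_pairing_pos:
  assumes "D \<in> semigroup_hull (descents A)"
  shows "0 < (\<Sum>e\<in>cells A. int (A $$ e) * D e)"
  using assms
proof induction
  case (base D)
  then obtain c d where cd: "D = transfer c d" "c \<in> cells A" "d \<in> cells A" "A $$ d < A $$ c"
    by (auto simp: descents_def)
  have "(\<Sum>e\<in>cells A. int (A $$ e) * D e)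
      = (\<Sum>e\<in>cells A. (if e = c then int (A $$ e) else 0) - (if e = d then int (A $$ e) else 0))"
    by (intro sum.cong) (auto simp: cd(1) transfer_def of_bool_def)
  also have "\<dots> = int (A $$ c) - int (A $$ d)"
    using cd by (simp add: sum_subtractf)
  finally show ?case using cd(4) by simp
next
  case (add u v)
  then show ?case by (simp add: distrib_left sum.distrib)
qed

text \<open>Every initial sum of \<open>B\<close> is its sum over some leading set. Such a set is leading for \<open>A\<close> as
  well, so \<open>D\<close> has a nonnegative sum over it, and \<open>C = B + D\<close> has a sum at least as large.
  The matrix \<open>C\<close> will be a multiple of \<open>A\<close>.\<close>

lemma dominance_le_perturbed:
  assumes D: "D \<in> semigroup_hull (descents A)" and total: "sum D (cells A) = 0"
    and cells: "cells B = cells A" "cells C = cells A"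
    and B: "\<And>c. c \<in> cells A \<Longrightarrow> int (B $$ c) = int (C $$ c) - D c"
    and order: "\<And>c d. c \<in> cells A \<Longrightarrow> d \<in> cells A \<Longrightarrow> A $$ d < A $$ c \<Longrightarrow> B $$ d < B $$ c"
  shows "dominance_le (pi_seq B) (pi_seq C)"
proof -
  have sum_B: "int (sum (($$) B) U) = int (sum (($$) C) U) - sum D U" if "U \<subseteq> cells A" for U
  proof -
    have "int (sum (($$) B) U) = (\<Sum>c\<in>U. int (C $$ c) - D c)"
      using that B by (auto simp: intro!: sum.cong)
    then show ?thesis by (simp add: sum_subtractf)
  qed
  have "sum_list (take k (pi_seq B)) \<le> sum_list (take k (pi_seq C))" for k
  proof -
    let ?k = "min k (card (cells A))"
    have "?k \<le> card (cells B)" using cells by simp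
    then obtain U where U: "leading (cells B) (($$) B) U" "card U = ?k"
        "sum (($$) B) U = sum_list (take ?k (pi_seq B))"
      using ex_leading_pi_seq by blast
    have sub: "U \<subseteq> cells A" using U(1) cells by (simp add: leading_def)
    have "leading (cells A) (($$) A) U"
      using U(1) order cells unfolding leading_def by (metis DiffD1 not_le subsetD)
    then have "int (sum (($$) B) U) \<le> int (sum (($$) C) U)"
      unfolding sum_B[OF sub] using sum_leading_descents_nonneg[OF D] by simp
    then have "sum (($$) B) U \<le> sum (($$) C) U"
      by (simp only: of_nat_le_iff)
    also have "\<dots> \<le> sum_list (take ?k (pi_seq C))"
      using sum_le_take_pi_seq[of U C] sub cells U(2) by simp
    finally have "sum_list (take ?k (pi_seq B)) \<le> sum_list (take ?k (pi_seq C))"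
      using U(3) by simp
    then show ?thesis
      using cells by (cases "k \<le> card (cells A)") (auto simp: length_pi_seq)
  qed
  moreover have "sum_list (pi_seq B) = sum_list (pi_seq C)"
  proof -
    have "int (sum (($$) B) (cells A)) = int (sum (($$) C) (cells A))"
      unfolding sum_B[OF order_refl] total by simp
    then show ?thesis
      unfolding sum_list_pi_seq cells by (simp only: of_nat_eq_iff)
  qed
  ultimately show ?thesis by (simp add: dominance_le_def)
qed

lemma not_additive_imp_ex_dominated:
  assumes "\<not> additive_mat A"
  shows "\<exists>n\<ge>1. \<exists>B\<in>margin_class (row_sums (n \<cdot>\<^sub>m A)) (col_sums (n \<cdot>\<^sub>m A)).
    B \<noteq> n \<cdot>\<^sub>m A \<and> dominance_le (pi_seq B) (pi_seq (n \<cdot>\<^sub>m A))"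
proof -
  obtain D where D: "D \<in> semigroup_hull (descents A)"
      and rows: "\<And>i. i < dim_row A \<Longrightarrow> (\<Sum>j<dim_col A. D (i, j)) = 0"
      and cols: "\<And>j. j < dim_col A \<Longrightarrow> (\<Sum>i<dim_row A. D (i, j)) = 0"
    using not_additive_imp_ex_margin_free[OF assms] by blast
  define M where "M = (\<Sum>c\<in>cells A. \<bar>D c\<bar>)"
  have M: "\<bar>D c\<bar> \<le> M" if "c \<in> cells A" for c
    using that member_le_sum[of c "cells A" "\<lambda>c. \<bar>D c\<bar>"] by (simp add: M_def)
  have "0 \<le> M" by (simp add: M_def sum_nonneg)
  \<comment> \<open>The factor 2 is for the differences \<open>D c - D d\<close>, which \<open>n\<close> has to exceed.\<close>
  define n where "n = nat (1 + 2 * M)"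
  have n: "int n = 1 + 2 * M" "1 \<le> n"
    using \<open>0 \<le> M\<close> by (auto simp: n_def)
  let ?C = "n \<cdot>\<^sub>m A"
  have C: "?C $$ c = n * A $$ c" if "c \<in> cells A" for c
    using that by (auto simp: cells_def)
  define B where "B = mat (dim_row A) (dim_col A) (\<lambda>c. nat (int (?C $$ c) - D c))"
  have dims: "dim_row B = dim_row A" "dim_col B = dim_col A"
    by (simp_all add: B_def)
  have cells_eq: "cells B = cells A" "cells ?C = cells A"
    using dims by (simp_all add: cells_def)
  have gap: "D c - D d < int n * int (A $$ c) - int n * int (A $$ d)"
    if "c \<in> cells A" "d \<in> cells A" "A $$ d < A $$ c" for c d
  proof -
    have "D c - D d < int n"
      using M[OF that(1)] M[OF that(2)] n by linarith
    also have "\<dots> \<le> int n * (int (A $$ c) - int (A $$ d))"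
      using that(3) n mult_left_mono[of 1 "int (A $$ c) - int (A $$ d)" "int n"] by simp
    finally show ?thesis by (simp add: right_diff_distrib)
  qed
  have B: "int (B $$ c) = int (?C $$ c) - D c" if c: "c \<in> cells A" for c
  proof -
    have "D c \<le> int (?C $$ c)"
    proof (cases "A $$ c = 0")
      case True
      then show ?thesis using descents_nonpos_at_zero[OF D True] C[OF c] by simp
    next
      case False
      have "D c \<le> int n" using M[OF c] n by linarith
      also have "int n \<le> int (?C $$ c)"
        unfolding C[OF c] of_nat_le_iff using False by simp
      finally show ?thesis .
    qed
    then show ?thesis using c by (auto simp: B_def cells_def)
  qed
  have "B $$ d < B $$ c" if "c \<in> cells A" "d \<in> cells A" "A $$ d < A $$ c" for c d
    using gap[OF that] B[OF that(1)] B[OF that(2)] C[OF that(1)] C[OF that(2)] by simp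
  moreover have "sum D (cells A) = 0"
    using rows by (simp add: cells_def sum.cartesian_product')
  ultimately have "dominance_le (pi_seq B) (pi_seq ?C)"
    using dominance_le_perturbed[OF D _ cells_eq B] by blast
  moreover have "B \<noteq> ?C"
  proof
    assume "B = ?C"
    then have "(\<Sum>c\<in>cells A. int (A $$ c) * D c) = 0"
      using B by (intro sum.neutral) auto
    then show False using descents_pairing_pos[OF D] by simp
  qed
  moreover have "B \<in> margin_class (row_sums ?C) (col_sums ?C)"
  proof (rule margin_classI)
    show "dim_row B = dim_row ?C" "dim_col B = dim_col ?C"
      using dims by simp_all
    show "(\<Sum>j<dim_col ?C. B $$ (i, j)) = (\<Sum>j<dim_col ?C. ?C $$ (i, j))" if "i < dim_row ?C" for i
    proof -
      have "int (\<Sum>j<dim_col A. B $$ (i, j)) = (\<Sum>j<dim_col A. int (?C $$ (i, j)) - D (i, j))"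
        using B that unfolding of_nat_sum by (intro sum.cong) (auto simp: cells_def)
      also have "\<dots> = int (\<Sum>j<dim_col A. ?C $$ (i, j))"
        using rows that by (simp add: sum_subtractf)
      finally show ?thesis by (simp only: of_nat_eq_iff index_smult_mat)
    qed
    show "(\<Sum>i<dim_row ?C. B $$ (i, j)) = (\<Sum>i<dim_row ?C. ?C $$ (i, j))" if "j < dim_col ?C" for j
    proof -
      have "int (\<Sum>i<dim_row A. B $$ (i, j)) = (\<Sum>i<dim_row A. int (?C $$ (i, j)) - D (i, j))"
        using B that unfolding of_nat_sum by (intro sum.cong) (auto simp: cells_def)
      also have "\<dots> = int (\<Sum>i<dim_row A. ?C $$ (i, j))"
        using cols that by (simp add: sum_subtractf)
      finally show ?thesis by (simp only: of_nat_eq_iff index_smult_mat)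
    qed
  qed
  ultimately show ?thesis using n(2) by blast
qed

lemma minimal_and_pi_unique_iff:
  "minimal_mat A \<and> pi_unique A \<longleftrightarrow>
    (\<forall>B\<in>margin_class (row_sums A) (col_sums A). dominance_le (pi_seq B) (pi_seq A) \<longrightarrow> B = A)"
  unfolding minimal_mat_def pi_unique_def dominance_less_def
  by (auto simp: dominance_le_def)

theorem additive_mat_iff_multiples_minimal_pi_unique:
  "additive_mat A \<longleftrightarrow> (\<forall>n\<ge>1. minimal_mat (n \<cdot>\<^sub>m A) \<and> pi_unique (n \<cdot>\<^sub>m A))"
  unfolding minimal_and_pi_unique_iff
  using additive_mat_rigid[OF additive_mat_smult] not_additive_imp_ex_dominated by blast

theorem theorem6p4:
  fixes A :: "nat mat"
  assumes "plane_partition A"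
  shows "additive_mat A \<longleftrightarrow>
    (\<forall>n::nat. n \<ge> 1 \<longrightarrow> minimal_mat (n \<cdot>\<^sub>m A) \<and> pi_unique (n \<cdot>\<^sub>m A))"
  by (rule additive_mat_iff_multiples_minimal_pi_unique)

end
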